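(* Let $n\ge 1$ and $k\ge 3$ be integers. For a generic tensor $\mathcal A\in\operatorname{S}(\otimes^k\mathbb R^n)$, each Z-eigenvector of $\mathcal A$ is nondegenerate. That is, there exists a proper Zariski closed subset $X\subset\operatorname{S}(\otimes^k\mathbb R^n)$ such that for every $\mathcal A\in\operatorname{S}(\otimes^k\mathbb R^n)\setminus X$ each Z-eigenvector of $\mathcal A$ is nondegenerate.
   Context: $\otimes^k\mathbb R^n$ is the space of real tensors $\mathcal A=(a_{i_1\dots i_k})$ of order $k$ and dimension $n\times\dots\times n$, and $\operatorname{S}(\otimes^k\mathbb R^n)$ is its subspace of symmetric tensors (entries invariant under all permutations of the indices), regarded as a finite-dimensional real affine space with its Zariski topology. The inner product is $\langle\mathcal A,\mathcal B\rangle=\sum_{i_1,\dots,i_k=1}^n a_{i_1\dots i_k}b_{i_1\dots i_k}$. For a vector $\mathbf x$ with entries $x_i$, $\mathbf x^{\otimes k}$ is the tensor with entries $x_{i_1}\cdots x_{i_k}$. $\mathbb S^{n-1}$ is the unit sphere in $\mathbb R^n$ for the Euclidean norm. A vector $\mathbf x\in\mathbb S^{n-1}$ is a Z-eigenvector of $\mathcal A$ if it is a critical point of the smooth function $S(\mathbf x):=\langle\mathcal A,\mathbf x^{\otimes k}\rangle$ on $\mathbb S^{n-1}$. A Z-eigenvector $\mathbf x$ is nondegenerate if it is a nondegenerate critical point of $S$ on $\mathbb S^{n-1}$, i.e., the Riemannian Hessian of $S$ at $\mathbf x$ (for the metric on the sphere induced from $\mathbb R^n$) is a nonsingular linear map from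 the tangent space of $\mathbb S^{n-1}$ at $\mathbf x$ to itself. A property is generic in a space $\mathbb F^N$ ($\mathbb F=\mathbb R$ or $\mathbb C$) if there is a proper Zariski closed subset $X\subset\mathbb F^N$ such that the property holds outside $X$. *)

theory Defs
  imports "HOL-Analysis.Analysis"
begin

section \<open>Tensors\<close>

text \<open>A multi-index \<open>i\<^sub>1 \<dots> i\<^sub>k\<close> is a function from the \<open>k\<close> index positions
  (the finite type \<open>'k\<close>, so that \<open>k\<close> is \<open>CARD('k)\<close>) to the \<open>n\<close> coordinates (the finite type
  \<open>'n\<close>). The library inner product on this vector type is the sum over all multi-indices of the
  products of the entries.\<close>

type_synonym ('k, 'n) tensor = "real ^ ('k \<Rightarrow> 'n)"

definition symmetric_tensors :: "('k::finite, 'n::finite) tensor set" where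
  "symmetric_tensors = {A. \<forall>p. p permutes UNIV \<longrightarrow> (\<forall>i. A $ (i \<circ> p) = A $ i)}"

definition tensor_power :: "real ^ 'n \<Rightarrow> ('k::finite, 'n::finite) tensor" where
  "tensor_power x = (\<chi> i. \<Prod>j\<in>UNIV. x $ (i j))"

section \<open>Zariski topology\<close>

text \<open>On a linear subspace \<open>V\<close> of a Euclidean space, the polynomial functions in linear
  coordinates of \<open>V\<close> are exactly the restrictions of polynomial functions on the whole space.\<close>

definition zariski_closed_in :: "'a::euclidean_space set \<Rightarrow> 'a set \<Rightarrow> bool" where
  "zariski_closed_in V X \<longleftrightarrow>
     (\<exists>P. (\<forall>p\<in>P. real_polynomial_function p) \<and> X = {a \<in> V. \<forall>p\<in>P. p a = 0})"

section \<open>Critical points on the unit sphere\<close>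

text \<open>Functions on the sphere are given by smooth functions on the ambient space. For \<open>x\<close> on the
  sphere, \<open>sphere_proj x\<close> is the orthogonal projection onto the tangent space at \<open>x\<close>.\<close>

definition sphere_tangent :: "'a::euclidean_space \<Rightarrow> 'a set" where
  "sphere_tangent x = {v. v \<bullet> x = 0}"

definition sphere_proj :: "'a::euclidean_space \<Rightarrow> 'a \<Rightarrow> 'a" where
  "sphere_proj x v = v - (v \<bullet> x) *\<^sub>R x"

definition sphere_critical_point :: "('a::euclidean_space \<Rightarrow> real) \<Rightarrow> 'a \<Rightarrow> bool" where
  "sphere_critical_point f x \<longleftrightarrow>
     x \<in> sphere 0 1 \<and> (\<forall>v\<in>sphere_tangent x. frechet_derivative f (at x) v = 0)"

definition sphere_grad :: "('a::euclidean_space \<Rightarrow> real) \<Rightarrow> 'a \<Rightarrow> 'a" where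
  "sphere_grad f x = sphere_proj x (THE D. GDERIV f x :> D)"

text \<open>The Riemannian Hessian sends a tangent vector \<open>v\<close> to the covariant derivative along \<open>v\<close> of the
  Riemannian gradient. For the induced metric, the Levi-Civita connection is the tangential part of
  the ambient directional derivative of any smooth extension of the vector field; the formula
  for \<open>sphere_grad\<close>, read off the sphere, is such an extension.\<close>

definition sphere_hessian :: "('a::euclidean_space \<Rightarrow> real) \<Rightarrow> 'a \<Rightarrow> 'a \<Rightarrow> 'a" where
  "sphere_hessian f x v = sphere_proj x (frechet_derivative (sphere_grad f) (at x) v)"

definition nondegenerate_sphere_critical_point :: "('a::euclidean_space \<Rightarrow> real) \<Rightarrow> 'a \<Rightarrow> bool"
  where
  "nondegenerate_sphere_critical_point f x \<longleftrightarrow>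
     sphere_critical_point f x \<and>
     bij_betw (sphere_hessian f x) (sphere_tangent x) (sphere_tangent x)"

section \<open>Z-eigenvectors\<close>

definition Z_eigenvector :: "('k::finite, 'n::finite) tensor \<Rightarrow> real ^ 'n \<Rightarrow> bool" where
  "Z_eigenvector A x \<longleftrightarrow> sphere_critical_point (\<lambda>y. A \<bullet> tensor_power y) x"

definition nondegenerate_Z_eigenvector ::
    "('k::finite, 'n::finite) tensor \<Rightarrow> real ^ 'n \<Rightarrow> bool" where
  "nondegenerate_Z_eigenvector A x \<longleftrightarrow>
     nondegenerate_sphere_critical_point (\<lambda>y. A \<bullet> tensor_power y) x"

end

theory Submission
  imports Defs "HOL-Combinatorics.Permutations"
begin

text \<open>The proof is a dimension count, carried out by elimination. Put \<open>n = CARD('n)\<close>, \<open>k = CARD('k)\<close>, and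
  let \<open>N\<close> be the dimension of the space of symmetric tensors. Let \<open>n \<ge> 2\<close>; for \<open>n = 1\<close> the tangent spaces
  of the sphere are trivial and nothing is degenerate. The tensors with a degenerate
  Z-eigenvector form a set that depends polynomially on \<open>N - 1\<close> parameters only, and the image of a
  polynomial map from \<open>N - 1\<close> to \<open>N\<close> variables lies in a hypersurface.

  Degeneracy at a unit vector \<open>x\<close> means that there is a unit vector \<open>v\<close> orthogonal to \<open>x\<close> in the kernel
  of the Riemannian Hessian. For the multilinear form of \<open>A\<close> this reads \<open>A(x,\<dots>,x,w) = 0\<close> and
  \<open>(k - 1) A(x,\<dots>,x,w,v) = A(x,\<dots>,x) (w \<bullet> v)\<close> for all \<open>w\<close> orthogonal to \<open>x\<close>
  (\<open>degenerate_Z_eigenvector_kernel\<close>). An orthogonal map that takes two fixed coordinate vectors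
  \<open>e\<^sub>a\<close>, \<open>e\<^sub>b\<close> to \<open>x\<close>, \<open>v\<close> turns these conditions into \<open>2 (n - 1)\<close> independent linear equations on the
  entries of the transported tensor \<open>B\<close> (\<open>degenerate_tensor_standard_position\<close>). The orthogonal map can
  be taken to be a product of two reflections in vectors \<open>u\<close> and \<open>w\<close> (\<open>orthonormal_pair_by_two_reflections\<close>).
  A reflection does not change when its vector is scaled, and \<open>x\<close>, \<open>v\<close> may be replaced by
  \<open>- x\<close>, \<open>- v\<close>; therefore one may demand \<open>u\<^sub>a = 1\<close>, \<open>w\<^sub>b = 1\<close>, and \<open>w\<^sub>a = 0\<close>, so that \<open>u\<close> has \<open>n - 1\<close> and
  \<open>w\<close> has \<open>n - 2\<close> free coordinates. The denominators of the reflections are absorbed into \<open>B\<close>,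
  which ranges over a linear space. Altogether there are
  \<open>(n - 1) + (n - 2) + (N - 2 (n - 1)) = N - 1\<close> parameters (\<open>degenerate_tensors_polynomial_image\<close>).

  The hypersurface comes from linear algebra (\<open>polynomial_image_in_hypersurface\<close>). There are
  \<open>(d + 1)\<^sup>N\<close> monomials in \<open>N\<close> variables with all exponents at most \<open>d\<close>. Composed with a polynomial map
  they lie in a space of polynomials in the parameters, of dimension \<open>O(d\<^sup>m)\<close> for \<open>m\<close> parameters. If
  \<open>m < N\<close> and \<open>d\<close> is large, some nontrivial combination of the monomials vanishes on the image.\<close>

section \<open>Polynomial images of smaller dimension\<close>

text \<open>Gaussian elimination: an equation with a nonzero coefficient at the unknown \<open>p\<close> is solved for \<open>p\<close>
  and substituted into the other equations.\<close>

lemma underdetermined_system_nontrivial_solution: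
  fixes M :: "'f \<Rightarrow> 'e \<Rightarrow> real"
  assumes "finite F" "finite E" "card F < card E"
  shows "\<exists>c. (\<exists>e\<in>E. c e \<noteq> 0) \<and> (\<forall>f\<in>F. (\<Sum>e\<in>E. M f e * c e) = 0)"
  using assms
proof (induction F arbitrary: E M rule: finite_induct)
  case empty
  then obtain e where "e \<in> E" by fastforce
  then show ?case by (intro exI[of _ "\<lambda>_. 1"]) auto
next
  case (insert f F)
  show ?case
  proof (cases "\<exists>e\<in>E. M f e \<noteq> 0")
    case False
    obtain c where "\<exists>e\<in>E. c e \<noteq> 0" "\<forall>g\<in>F. (\<Sum>e\<in>E. M g e * c e) = 0"
      using insert.IH[of E M] insert.prems insert.hyps by auto
    then show ?thesis using False by (intro exI[of _ c]) auto
  next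
    case True
    then obtain p where p: "p \<in> E" "M f p \<noteq> 0" by auto
    \<comment> \<open>The coefficients after the unknown \<open>p\<close> is eliminated with the help of equation \<open>f\<close>.\<close>
    define M' where "M' g e = M g e - M g p * M f e / M f p" for g e
    have "card F < card (E - {p})"
      using insert.prems insert.hyps p by auto
    then obtain c where c: "\<exists>e\<in>E - {p}. c e \<noteq> 0"
      and c0: "\<And>g. g \<in> F \<Longrightarrow> (\<Sum>e\<in>E - {p}. M' g e * c e) = 0"
      using insert.IH[of "E - {p}" M'] insert.prems by auto
    define s where "s = (\<Sum>e\<in>E - {p}. M f e * c e)"
    define c' where "c' = c(p := - s / M f p)"
    have split: "(\<Sum>e\<in>E. M g e * c' e) = M g p * (- s / M f p) + (\<Sum>e\<in>E - {p}. M g e * c e)" for g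
    proof -
      have "(\<Sum>e\<in>E. M g e * c' e) = M g p * c' p + (\<Sum>e\<in>E - {p}. M g e * c' e)"
        using insert.prems p by (simp add: sum.remove)
      also have "(\<Sum>e\<in>E - {p}. M g e * c' e) = (\<Sum>e\<in>E - {p}. M g e * c e)"
        by (intro sum.cong) (auto simp: c'_def)
      finally show ?thesis by (simp add: c'_def)
    qed
    have "(\<Sum>e\<in>E. M g e * c' e) = 0" if "g \<in> F" for g
    proof -
      have "0 = (\<Sum>e\<in>E - {p}. M g e * c e - (M g p / M f p) * (M f e * c e))"
        using c0[OF that] by (simp add: M'_def algebra_simps)
      also have "\<dots> = (\<Sum>e\<in>E - {p}. M g e * c e) - (M g p / M f p) * s"
        by (simp add: sum_subtractf sum_distrib_left s_def)
      finally show ?thesis unfolding split by simp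
    qed
    moreover have "(\<Sum>e\<in>E. M f e * c' e) = 0"
      unfolding split s_def[symmetric] using p by simp
    moreover have "\<exists>e\<in>E. c' e \<noteq> 0" using c by (auto simp: c'_def)
    ultimately show ?thesis by (intro exI[of _ c']) auto
  qed
qed

text \<open>Exponents are bounded variable by variable, because the number of monomials is then a plain power,
  \<open>(D + 1) ^ card J\<close>. They are extensional functions on the set of variables, so that distinct exponents
  are distinct monomials.\<close>

abbreviation exponents :: "'j set \<Rightarrow> nat \<Rightarrow> ('j \<Rightarrow> nat) set" where
  "exponents J D \<equiv> J \<rightarrow>\<^sub>E {..D}"

definition monomial :: "'j set \<Rightarrow> ('j \<Rightarrow> nat) \<Rightarrow> ('j \<Rightarrow> real) \<Rightarrow> real" where
  "monomial J \<beta> t = (\<Prod>j\<in>J. t j ^ \<beta> j)"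

definition poly_deg_le :: "'j set \<Rightarrow> nat \<Rightarrow> (('j \<Rightarrow> real) \<Rightarrow> real) \<Rightarrow> bool" where
  "poly_deg_le J D g \<longleftrightarrow>
     (\<exists>M. \<forall>t. g t = (\<Sum>\<beta>\<in>exponents J D. M \<beta> * monomial J \<beta> t))"

definition poly_in :: "'j set \<Rightarrow> (('j \<Rightarrow> real) \<Rightarrow> real) \<Rightarrow> bool" where
  "poly_in J g \<longleftrightarrow> (\<exists>D. poly_deg_le J D g)"

text \<open>One variable at a time: the polynomial is a univariate polynomial in the new variable, and its
  coefficients are polynomials in the other variables, one of which is nonzero by induction.\<close>

lemma nonzero_polynomial_nonvanishing:
  fixes c :: "('i \<Rightarrow> nat) \<Rightarrow> real"
  assumes "finite I" "\<alpha> \<in> exponents I d" "c \<alpha> \<noteq> 0"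
  shows "\<exists>a. (\<Sum>\<alpha>\<in>exponents I d. c \<alpha> * monomial I \<alpha> a) \<noteq> 0"
  using assms
proof (induction I arbitrary: c \<alpha> rule: finite_induct)
  case empty
  then show ?case by (simp add: monomial_def)
next
  case (insert i I)
  define c' where "c' n \<beta> = c (\<beta>(i := n))" for n \<beta>
  have \<beta>: "restrict \<alpha> I \<in> exponents I d" "c' (\<alpha> i) (restrict \<alpha> I) \<noteq> 0"
  proof -
    have "(restrict \<alpha> I)(i := \<alpha> i) = \<alpha>"
      using insert.prems insert.hyps by (auto simp: fun_eq_iff PiE_def extensional_def)
    then show "c' (\<alpha> i) (restrict \<alpha> I) \<noteq> 0" using insert.prems by (simp add: c'_def)
  qed (use insert.prems in auto)
  define S where "S n a = (\<Sum>\<beta>\<in>exponents I d. c' n \<beta> * monomial I \<beta> a)" for n a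
  obtain a where a: "S (\<alpha> i) a \<noteq> 0"
    using insert.IH[where c = "c' (\<alpha> i)", OF \<beta>] by (auto simp: S_def)
  have "\<alpha> i \<le> d" using insert.prems by (auto simp: PiE_def)
  then obtain x where x: "(\<Sum>n\<le>d. S n a * x ^ n) \<noteq> 0"
    using a Transcendental.polyfun_eq_0[of "\<lambda>n. S n a" d] by blast
  have mon: "monomial (insert i I) (\<beta>(i := n)) (a(i := x)) = x ^ n * monomial I \<beta> a" for \<beta> n
  proof -
    have "(\<Prod>j\<in>I. (a(i := x)) j ^ (\<beta>(i := n)) j) = (\<Prod>j\<in>I. a j ^ \<beta> j)"
      using insert.hyps by (intro prod.cong) auto
    then show ?thesis using insert.hyps by (simp add: monomial_def)
  qed
  have "(\<Sum>\<alpha>\<in>exponents (insert i I) d. c \<alpha> * monomial (insert i I) \<alpha> (a(i := x)))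
      = (\<Sum>(n,\<beta>)\<in>{..d} \<times> exponents I d. c (\<beta>(i := n)) * monomial (insert i I) (\<beta>(i := n)) (a(i := x)))"
  proof -
    have "inj_on (\<lambda>(n,\<beta>). \<beta>(i := n)) ({..d} \<times> exponents I d)"
      using inj_combinator[OF insert.hyps(2), of "\<lambda>_. {..d}"] by (simp add: case_prod_unfold)
    then show ?thesis
      unfolding PiE_insert_eq by (subst sum.reindex) (auto simp: case_prod_unfold)
  qed
  also have "\<dots> = (\<Sum>n\<le>d. \<Sum>\<beta>\<in>exponents I d. c' n \<beta> * (x ^ n * monomial I \<beta> a))"
    by (simp add: sum.cartesian_product mon c'_def)
  also have "\<dots> = (\<Sum>n\<le>d. S n a * x ^ n)"
    by (simp add: S_def sum_distrib_left mult_ac)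
  finally show ?case using x by metis
qed

lemma poly_deg_le_zero: "poly_deg_le J D (\<lambda>_. 0)"
  unfolding poly_deg_le_def by (intro exI[of _ "\<lambda>_. 0"]) simp

lemma poly_deg_le_add:
  assumes "poly_deg_le J D f" "poly_deg_le J D g"
  shows "poly_deg_le J D (\<lambda>t. f t + g t)"
proof -
  obtain M N where "\<And>t. f t = (\<Sum>\<beta>\<in>exponents J D. M \<beta> * monomial J \<beta> t)"
    "\<And>t. g t = (\<Sum>\<beta>\<in>exponents J D. N \<beta> * monomial J \<beta> t)"
    using assms unfolding poly_deg_le_def by auto
  then show ?thesis unfolding poly_deg_le_def
    by (intro exI[of _ "\<lambda>\<beta>. M \<beta> + N \<beta>"]) (simp add: algebra_simps sum.distrib)
qed

lemma poly_deg_le_sum: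
  assumes "\<And>i. i \<in> S \<Longrightarrow> poly_deg_le J D (f i)"
  shows "poly_deg_le J D (\<lambda>t. \<Sum>i\<in>S. f i t)"
  using assms by (induction S rule: infinite_finite_induct) (auto simp: poly_deg_le_zero poly_deg_le_add)

lemma poly_deg_le_monomial:
  assumes "finite J" "\<beta> \<in> exponents J D"
  shows "poly_deg_le J D (\<lambda>t. c * monomial J \<beta> t)"
  unfolding poly_deg_le_def
proof (intro exI allI)
  fix t
  have "finite (exponents J D)" using assms by (simp add: finite_PiE)
  then show "c * monomial J \<beta> t = (\<Sum>\<gamma>\<in>exponents J D. (if \<gamma> = \<beta> then c else 0) * monomial J \<gamma> t)"
    using assms by (simp add: if_distrib[of "\<lambda>x. x * _"] cong: if_cong)
qed

lemma poly_deg_le_mult: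
  assumes J: "finite J" and f: "poly_deg_le J D f" and g: "poly_deg_le J D' g"
  shows "poly_deg_le J (D + D') (\<lambda>t. f t * g t)"
proof -
  obtain M N where M: "\<And>t. f t = (\<Sum>\<beta>\<in>exponents J D. M \<beta> * monomial J \<beta> t)"
    and N: "\<And>t. g t = (\<Sum>\<beta>\<in>exponents J D'. N \<beta> * monomial J \<beta> t)"
    using f g unfolding poly_deg_le_def by auto
  have mon: "monomial J \<beta> t * monomial J \<gamma> t = monomial J (\<lambda>j\<in>J. \<beta> j + \<gamma> j) t" for \<beta> \<gamma> t
    by (simp add: monomial_def prod.distrib[symmetric] power_add)
  have "(\<lambda>t. f t * g t) = (\<lambda>t. \<Sum>\<beta>\<in>exponents J D. \<Sum>\<gamma>\<in>exponents J D'.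
          (M \<beta> * N \<gamma>) * monomial J (\<lambda>j\<in>J. \<beta> j + \<gamma> j) t)"
    by (simp add: M N sum_product mon[symmetric] mult_ac)
  then show ?thesis
    using J by (auto intro!: poly_deg_le_sum poly_deg_le_monomial simp: PiE_iff add_mono)
qed

lemma poly_deg_le_mono:
  assumes J: "finite J" and f: "poly_deg_le J D f" and "D \<le> D'"
  shows "poly_deg_le J D' f"
proof -
  obtain M where M: "\<And>t. f t = (\<Sum>\<beta>\<in>exponents J D. M \<beta> * monomial J \<beta> t)"
    using f unfolding poly_deg_le_def by auto
  have "poly_deg_le J D' (\<lambda>t. \<Sum>\<beta>\<in>exponents J D. M \<beta> * monomial J \<beta> t)"
    using J \<open>D \<le> D'\<close> by (intro poly_deg_le_sum poly_deg_le_monomial) (auto simp: PiE_iff)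
  then show ?thesis using M by presburger
qed

lemma poly_deg_le_const:
  assumes "finite J" shows "poly_deg_le J D (\<lambda>_. c)"
proof -
  have "poly_deg_le J D (\<lambda>t. c * monomial J (\<lambda>j\<in>J. 0) t)"
    using assms by (intro poly_deg_le_monomial) auto
  then show ?thesis by (simp add: monomial_def)
qed

lemma poly_deg_le_power:
  assumes J: "finite J" and f: "poly_deg_le J D f"
  shows "poly_deg_le J (n * D) (\<lambda>t. f t ^ n)"
  by (induction n) (use assms in \<open>auto simp: poly_deg_le_const poly_deg_le_mult\<close>)

lemma poly_deg_le_prod:
  assumes J: "finite J" and "\<And>i. i \<in> S \<Longrightarrow> poly_deg_le J D (f i)"
  shows "poly_deg_le J (card S * D) (\<lambda>t. \<Prod>i\<in>S. f i t)"
  using assms(2)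
  by (induction S rule: infinite_finite_induct) (use J in \<open>auto simp: poly_deg_le_const poly_deg_le_mult\<close>)

lemma poly_in_const: "finite J \<Longrightarrow> poly_in J (\<lambda>_. c)"
  using poly_deg_le_const unfolding poly_in_def by blast

lemma poly_in_var:
  assumes "finite J" "j \<in> J" shows "poly_in J (\<lambda>t. t j)"
proof -
  have "poly_deg_le J 1 (\<lambda>t. 1 * monomial J (\<lambda>i\<in>J. if i = j then 1 else 0) t)"
    using assms by (intro poly_deg_le_monomial) auto
  moreover have "monomial J (\<lambda>i\<in>J. if i = j then 1 else 0) t = t j" for t
    using assms by (simp add: monomial_def if_distrib[of "\<lambda>n. _ ^ n"] cong: if_cong)
  ultimately show ?thesis unfolding poly_in_def by auto
qed

lemma poly_in_add:
  assumes "finite J" "poly_in J f" "poly_in J g" shows "poly_in J (\<lambda>t. f t + g t)"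
proof -
  obtain D D' where "poly_deg_le J D f" "poly_deg_le J D' g"
    using assms unfolding poly_in_def by auto
  then have "poly_deg_le J (max D D') (\<lambda>t. f t + g t)"
    using \<open>finite J\<close> by (intro poly_deg_le_add) (auto intro: poly_deg_le_mono)
  then show ?thesis unfolding poly_in_def by blast
qed

lemma poly_in_mult:
  "finite J \<Longrightarrow> poly_in J f \<Longrightarrow> poly_in J g \<Longrightarrow> poly_in J (\<lambda>t. f t * g t)"
  unfolding poly_in_def using poly_deg_le_mult by blast

lemma poly_in_diff:
  assumes "finite J" "poly_in J f" "poly_in J g" shows "poly_in J (\<lambda>t. f t - g t)"
  using poly_in_add[OF assms(1,2) poly_in_mult[OF assms(1) poly_in_const[OF assms(1), of "-1"] assms(3)]]
  by simp

lemma poly_in_sum: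
  assumes "finite J" "\<And>i. i \<in> S \<Longrightarrow> poly_in J (f i)" shows "poly_in J (\<lambda>t. \<Sum>i\<in>S. f i t)"
  using assms(2)
  by (induction S rule: infinite_finite_induct) (use assms(1) in \<open>auto simp: poly_in_const poly_in_add\<close>)

lemma poly_in_prod:
  assumes "finite J" "\<And>i. i \<in> S \<Longrightarrow> poly_in J (f i)" shows "poly_in J (\<lambda>t. \<Prod>i\<in>S. f i t)"
  using assms(2)
  by (induction S rule: infinite_finite_induct) (use assms(1) in \<open>auto simp: poly_in_const poly_in_mult\<close>)

text \<open>The count behind the elimination: \<open>N\<close> coordinate functions of degree at most \<open>D\<close> turn a monomial with
  exponents at most \<open>d\<close> into a polynomial of degree at most \<open>N * (d * D)\<close> in each of the \<open>m\<close> parameters. The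
  left side grows like \<open>d ^ m\<close>, the right side like \<open>d ^ N\<close>.\<close>

lemma exists_more_exponents:
  fixes N D m :: nat
  assumes "m < N"
  shows "\<exists>d. (N * (d * D) + 1) ^ m < (d + 1) ^ N"
proof -
  define C where "C = N * D + 1"
  \<comment> \<open>One extra factor \<open>d + 1\<close> on the right absorbs the constant \<open>C ^ m\<close>.\<close>
  define d where "d = C ^ m"
  have "N * (d * D) + 1 \<le> C * (d + 1)" by (simp add: C_def algebra_simps)
  then have "(N * (d * D) + 1) ^ m \<le> (C * (d + 1)) ^ m" by (rule power_mono) simp
  also have "\<dots> = d * (d + 1) ^ m" unfolding d_def by (rule power_mult_distrib)
  also have "\<dots> < (d + 1) ^ Suc m" by simp
  also have "\<dots> \<le> (d + 1) ^ N" using assms by (intro power_increasing) auto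
  finally show ?thesis by blast
qed

text \<open>A polynomial map into a space of larger dimension satisfies a nontrivial polynomial relation. By
  \<open>exists_more_exponents\<close> the pulled back monomials outnumber the monomials in the parameters, hence
  they are linearly dependent; the relation is not the zero function by
  \<open>nonzero_polynomial_nonvanishing\<close>.\<close>

theorem polynomial_image_in_hypersurface:
  fixes \<phi> :: "'i \<Rightarrow> ('j \<Rightarrow> real) \<Rightarrow> real"
  assumes I: "finite I" and J: "finite J" and less: "card J < card I"
    and poly: "\<And>i. i \<in> I \<Longrightarrow> poly_in J (\<phi> i)"
  obtains d c where "\<And>t. (\<Sum>\<alpha>\<in>exponents I d. c \<alpha> * monomial I \<alpha> (\<lambda>i. \<phi> i t)) = 0"
    and "\<exists>a. (\<Sum>\<alpha>\<in>exponents I d. c \<alpha> * monomial I \<alpha> a) \<noteq> 0"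
proof -
  obtain D where D: "\<And>i. i \<in> I \<Longrightarrow> poly_deg_le J D (\<phi> i)"
  proof -
    obtain D' where D': "\<And>i. i \<in> I \<Longrightarrow> poly_deg_le J (D' i) (\<phi> i)"
      using poly unfolding poly_in_def by metis
    have "poly_deg_le J (\<Sum>i\<in>I. D' i) (\<phi> i)" if "i \<in> I" for i
      using poly_deg_le_mono[OF J D'[OF that]] I that by (simp add: member_le_sum)
    then show ?thesis using that by blast
  qed
  obtain d where d: "(card I * (d * D) + 1) ^ card J < (d + 1) ^ card I"
    using exists_more_exponents[OF less] by blast
  define K where "K = card I * (d * D)"
  have "poly_deg_le J K (\<lambda>t. monomial I \<alpha> (\<lambda>i. \<phi> i t))" if "\<alpha> \<in> exponents I d" for \<alpha>
    unfolding monomial_def K_def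
  proof (rule poly_deg_le_prod[OF J])
    fix i assume i: "i \<in> I"
    then have "\<alpha> i * D \<le> d * D" using that by (intro mult_right_mono) auto
    then show "poly_deg_le J (d * D) (\<lambda>t. \<phi> i t ^ \<alpha> i)"
      using poly_deg_le_mono[OF J poly_deg_le_power[OF J D[OF i]]] by blast
  qed
  then obtain M where M: "\<And>\<alpha> t. \<alpha> \<in> exponents I d \<Longrightarrow>
      monomial I \<alpha> (\<lambda>i. \<phi> i t) = (\<Sum>\<beta>\<in>exponents J K. M \<alpha> \<beta> * monomial J \<beta> t)"
    unfolding poly_deg_le_def by metis
  have "card (exponents J K) < card (exponents I d)"
    using d I J by (simp add: card_PiE K_def)
  then obtain c where c: "\<exists>\<alpha>\<in>exponents I d. c \<alpha> \<noteq> 0"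
    and c0: "\<And>\<beta>. \<beta> \<in> exponents J K \<Longrightarrow> (\<Sum>\<alpha>\<in>exponents I d. M \<alpha> \<beta> * c \<alpha>) = 0"
    using underdetermined_system_nontrivial_solution
      [of "exponents J K" "exponents I d" "\<lambda>\<beta> \<alpha>. M \<alpha> \<beta>"] I J
    by (auto simp: finite_PiE)
  have "(\<Sum>\<alpha>\<in>exponents I d. c \<alpha> * monomial I \<alpha> (\<lambda>i. \<phi> i t)) = 0" for t
  proof -
    have "(\<Sum>\<alpha>\<in>exponents I d. c \<alpha> * monomial I \<alpha> (\<lambda>i. \<phi> i t))
        = (\<Sum>\<alpha>\<in>exponents I d. \<Sum>\<beta>\<in>exponents J K. M \<alpha> \<beta> * c \<alpha> * monomial J \<beta> t)"
      by (simp add: M sum_distrib_left mult_ac)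
    also have "\<dots> = (\<Sum>\<beta>\<in>exponents J K. (\<Sum>\<alpha>\<in>exponents I d. M \<alpha> \<beta> * c \<alpha>) * monomial J \<beta> t)"
      by (subst sum.swap) (simp add: sum_distrib_right)
    also have "\<dots> = 0" by (simp add: c0)
    finally show ?thesis .
  qed
  moreover have "\<exists>a. (\<Sum>\<alpha>\<in>exponents I d. c \<alpha> * monomial I \<alpha> a) \<noteq> 0"
    using c nonzero_polynomial_nonvanishing[OF I] by blast
  ultimately show ?thesis using that by blast
qed

section \<open>Tensors as multilinear forms\<close>

definition multilinear_form :: "('k::finite, 'n::finite) tensor \<Rightarrow> ('k \<Rightarrow> real ^ 'n) \<Rightarrow> real" where
  "multilinear_form A X = (\<Sum>i\<in>UNIV. A $ i * (\<Prod>j\<in>UNIV. X j $ i j))"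

lemma inner_tensor_power: "A \<bullet> tensor_power y = multilinear_form A (\<lambda>_. y)"
  by (simp add: multilinear_form_def tensor_power_def inner_vec_def)

text \<open>Every special value of the form that matters below has equal arguments except in one or two slots,
  and is written with function updates; this lemma isolates the updated slot.\<close>

lemma prod_fun_upd_remove:
  fixes X :: "'k::finite \<Rightarrow> real ^ 'n"
  shows "(\<Prod>j\<in>UNIV. (X(p := v)) j $ i j) = v $ i p * (\<Prod>j\<in>UNIV - {p}. X j $ i j)"
proof -
  have "(\<Prod>j\<in>UNIV - {p}. (X(p := v)) j $ i j) = (\<Prod>j\<in>UNIV - {p}. X j $ i j)"
    by (intro prod.cong) auto
  then show ?thesis by (subst prod.remove[of _ p]) auto
qed

lemma linear_multilinear_form_slot: "linear (\<lambda>v. multilinear_form A (X(p := v)))"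
  by (intro linearI; unfold multilinear_form_def prod_fun_upd_remove)
    (simp_all add: algebra_simps sum.distrib sum_distrib_left)

lemma multilinear_form_axis: "multilinear_form A (\<lambda>j. axis (i j) 1) = A $ i"
proof -
  have "(\<Prod>j\<in>UNIV. axis (i j) 1 $ i' j) = (if i' = i then 1 else 0 :: real)" for i'
    by (auto simp: axis_def fun_eq_iff prod_zero_iff)
  then show ?thesis
    by (simp add: multilinear_form_def if_distrib[of "\<lambda>x. _ * x"] cong: if_cong)
qed

text \<open>The product rule. With each argument either constant or equal to the variable it gives the first and the second
  derivative of the power form.\<close>

lemma has_derivative_multilinear_form:
  fixes X :: "'k::finite \<Rightarrow> 'a::real_normed_vector \<Rightarrow> real ^ 'n::finite"
  assumes "\<And>j. (X j has_derivative X' j) (at x)"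
  shows "((\<lambda>y. multilinear_form A (\<lambda>j. X j y)) has_derivative
      (\<lambda>v. \<Sum>j\<in>UNIV. multilinear_form A ((\<lambda>j. X j x)(j := X' j v)))) (at x)"
proof -
  have comp: "((\<lambda>y. X j y $ m) has_derivative (\<lambda>v. X' j v $ m)) (at x)" for j m
    using bounded_linear.has_derivative[OF bounded_linear_vec_nth assms] .
  have "((\<lambda>y. multilinear_form A (\<lambda>j. X j y)) has_derivative
     (\<lambda>v. \<Sum>i\<in>UNIV. A $ i * (\<Sum>j\<in>UNIV. X' j v $ i j * (\<Prod>l\<in>UNIV - {j}. X l x $ i l)))) (at x)"
    unfolding multilinear_form_def by (intro derivative_intros comp)
  moreover have "(\<Sum>i\<in>UNIV. A $ i * (\<Sum>j\<in>UNIV. X' j v $ i j * (\<Prod>l\<in>UNIV - {j}. X l x $ i l)))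
     = (\<Sum>j\<in>UNIV. multilinear_form A ((\<lambda>j. X j x)(j := X' j v)))" for v
    unfolding multilinear_form_def prod_fun_upd_remove sum_distrib_left by (rule sum.swap)
  ultimately show ?thesis by simp
qed

lemma multilinear_form_permute:
  assumes A: "A \<in> symmetric_tensors" and p: "p permutes UNIV"
  shows "multilinear_form A (X \<circ> p) = multilinear_form A X"
proof -
  have "multilinear_form A (X \<circ> p) = (\<Sum>i\<in>UNIV. A $ (i \<circ> p) * (\<Prod>j\<in>UNIV. X (p j) $ (i \<circ> p) j))"
  proof -
    have "bij (\<lambda>i. i \<circ> p)" using p
      by (intro bij_betw_byWitness[where f' = "\<lambda>i. i \<circ> inv p"])
        (auto simp: comp_assoc permutes_inv_o)
    then show ?thesis unfolding multilinear_form_def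
      by (subst sum.reindex_bij_betw[symmetric, of "\<lambda>i. i \<circ> p" UNIV UNIV]) auto
  qed
  also have "\<dots> = (\<Sum>i\<in>UNIV. A $ i * (\<Prod>j\<in>UNIV. X j $ i j))"
  proof (intro sum.cong refl arg_cong2[where f = "(*)"])
    show "A $ (i \<circ> p) = A $ i" for i using A p by (auto simp: symmetric_tensors_def)
    show "(\<Prod>j\<in>UNIV. X (p j) $ (i \<circ> p) j) = (\<Prod>j\<in>UNIV. X j $ i j)" for i
      using prod.reindex_bij_betw[OF permutes_imp_bij[OF p], of "\<lambda>j. X j $ i j"] by simp
  qed
  finally show ?thesis by (simp add: multilinear_form_def)
qed

lemma multilinear_form_fun_upd_swap:
  assumes "A \<in> symmetric_tensors"
  shows "multilinear_form A ((\<lambda>_. y)(p := v)) = multilinear_form A ((\<lambda>_. y)(q := v))"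
proof -
  have "(\<lambda>_. y)(p := v) = ((\<lambda>_. y)(q := v)) \<circ> Transposition.transpose p q"
    by (auto simp: fun_eq_iff Transposition.transpose_def)
  then show ?thesis
    using multilinear_form_permute[OF assms permutes_swap_id[of p UNIV q], of "(\<lambda>_. y)(q := v)"] by simp
qed

lemma multilinear_form_fun_upd2_swap:
  assumes "A \<in> symmetric_tensors" "p \<noteq> q" "p \<noteq> r"
  shows "multilinear_form A ((\<lambda>_. y)(p := w, q := v)) = multilinear_form A ((\<lambda>_. y)(p := w, r := v))"
proof -
  have "(\<lambda>_. y)(p := w, q := v) = ((\<lambda>_. y)(p := w, r := v)) \<circ> Transposition.transpose q r"
    using assms by (auto simp: fun_eq_iff Transposition.transpose_def)
  then show ?thesis
    using multilinear_form_permute[OF assms(1) permutes_swap_id[of q UNIV r], of "(\<lambda>_. y)(p := w, r := v)"] by simp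
qed

text \<open>The tensor whose multilinear form is that of \<open>A\<close> with \<open>g\<close> applied to every argument, for linear \<open>g\<close>.\<close>

definition pull_back :: "(real ^ 'n \<Rightarrow> real ^ 'n) \<Rightarrow> ('k::finite, 'n::finite) tensor \<Rightarrow> ('k, 'n) tensor" where
  "pull_back g A = (\<chi> i. multilinear_form A (\<lambda>j. g (axis (i j) 1)))"

lemma multilinear_form_pull_back:
  fixes A :: "('k::finite, 'n::finite) tensor"
  assumes "linear g"
  shows "multilinear_form (pull_back g A) X = multilinear_form A (\<lambda>j. g (X j))"
proof -
  have g: "g (X j) $ m = (\<Sum>l\<in>UNIV. X j $ l * g (axis l 1) $ m)" for j m
  proof -
    have "g (X j) = g (\<Sum>l\<in>UNIV. X j $ l *\<^sub>R axis l 1)"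
      by (simp add: basis_expansion flip: scalar_mult_eq_scaleR)
    also have "\<dots> = (\<Sum>l\<in>UNIV. X j $ l *\<^sub>R g (axis l 1))"
      using assms by (simp add: linear_sum linear_scale)
    finally show ?thesis by (simp add: sum_component)
  qed
  have pr: "(\<Prod>j\<in>UNIV. g (X j) $ i j)
      = (\<Sum>i'\<in>UNIV. (\<Prod>j\<in>UNIV. X j $ i' j) * (\<Prod>j\<in>UNIV. g (axis (i' j) 1) $ i j))" for i :: "'k \<Rightarrow> 'n"
    unfolding g by (subst prod_sum_PiE) (auto simp: prod.distrib)
  have "multilinear_form A (\<lambda>j. g (X j)) = (\<Sum>i\<in>UNIV. \<Sum>i'\<in>UNIV.
      A $ i * (\<Prod>j\<in>UNIV. g (axis (i' j) 1) $ i j) * (\<Prod>j\<in>UNIV. X j $ i' j))"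
    unfolding multilinear_form_def pr sum_distrib_left by (simp add: mult_ac)
  also have "\<dots> = multilinear_form (pull_back g A) X"
    unfolding multilinear_form_def pull_back_def
    by (subst sum.swap) (simp add: sum_distrib_right)
  finally show ?thesis by simp
qed

lemma pull_back_symmetric:
  assumes "A \<in> symmetric_tensors" shows "pull_back g A \<in> symmetric_tensors"
  using multilinear_form_permute[OF assms]
  by (auto simp: symmetric_tensors_def pull_back_def o_def)

lemma multilinear_form_scale:
  "multilinear_form A (\<lambda>j. c *\<^sub>R X j) = c ^ CARD('k) * multilinear_form A X"
  for A :: "('k::finite, 'n::finite) tensor"
  by (simp add: multilinear_form_def prod.distrib sum_distrib_left mult_ac)

section \<open>Critical points and the Riemannian Hessian of the power form\<close>

text \<open>The Hessian maps the tangent space into itself, so by finite dimension it can fail to be bijective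
  only by having a kernel.\<close>

lemma degenerate_sphere_critical_point_kernel:
  assumes crit: "sphere_critical_point f x" and nd: "\<not> nondegenerate_sphere_critical_point f x"
    and lin: "linear (sphere_hessian f x)"
  obtains v where "v \<in> sphere_tangent x" "v \<noteq> 0" "sphere_hessian f x v = 0"
proof -
  let ?h = "sphere_hessian f x" and ?T = "sphere_tangent x"
  have x: "x \<bullet> x = 1" using crit by (simp add: sphere_critical_point_def dot_square_norm)
  have T: "subspace ?T"
    by (auto simp: subspace_def sphere_tangent_def inner_add_left)
  have hT: "?h ` ?T \<subseteq> ?T"
    using x by (auto simp: sphere_tangent_def sphere_hessian_def sphere_proj_def inner_diff_left)
  have "\<not> inj_on ?h ?T"
  proof
    assume inj: "inj_on ?h ?T"
    then have "dim (?h ` ?T) = dim ?T" using lin T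
      by (intro dim_image_eq) (auto simp: span_eq_iff[THEN iffD2])
    then have "?h ` ?T = ?T"
      using hT T lin by (intro subspace_dim_equal linear_subspace_image) auto
    then show False using inj nd crit
      by (auto simp: nondegenerate_sphere_critical_point_def bij_betw_def)
  qed
  then obtain v w where vw: "v \<in> ?T" "w \<in> ?T" "v \<noteq> w" "?h v = ?h w" by (auto simp: inj_on_def)
  show ?thesis
  proof (rule that[of "v - w"])
    show "v - w \<in> ?T" using vw T by (simp add: subspace_diff)
    show "v - w \<noteq> 0" using vw by simp
    show "?h (v - w) = 0" using vw lin by (simp add: linear_diff)
  qed
qed

lemma inner_form_coordinates:
  fixes g :: "real ^ 'n::finite \<Rightarrow> real"
  assumes "linear g"
  shows "w \<bullet> (\<chi> m. g (axis m 1)) = g w"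
proof -
  have "g w = g (\<Sum>m\<in>UNIV. w $ m *\<^sub>R axis m 1)"
    by (simp add: basis_expansion flip: scalar_mult_eq_scaleR)
  also have "\<dots> = (\<Sum>m\<in>UNIV. w $ m * g (axis m 1))"
    using assms by (simp add: linear_sum linear_scale)
  finally show ?thesis by (simp add: inner_vec_def)
qed

context
  fixes A :: "('k::finite, 'n::finite) tensor" and p q :: 'k
  assumes A: "A \<in> symmetric_tensors" and pq: "p \<noteq> q"
begin

text \<open>For symmetric \<open>A\<close> all slots are alike, so the gradient and the Hessian of the power form on the whole
  space can be written with the fixed slots \<open>p\<close> and \<open>q\<close>.\<close>

definition ambient_grad :: "real ^ 'n \<Rightarrow> real ^ 'n" where
  "ambient_grad y = (\<chi> m. real CARD('k) * multilinear_form A ((\<lambda>_. y)(p := axis m 1)))"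

definition ambient_hess :: "real ^ 'n \<Rightarrow> real ^ 'n \<Rightarrow> real ^ 'n" where
  "ambient_hess y v = (\<chi> m. real CARD('k) * (real (CARD('k) - 1) *
     multilinear_form A ((\<lambda>_. y)(p := axis m 1, q := v))))"

lemma inner_ambient_grad:
  "w \<bullet> ambient_grad y = real CARD('k) * multilinear_form A ((\<lambda>_. y)(p := w))"
proof -
  note lin = linear_multilinear_form_slot[of A "\<lambda>_. y" p]
  have "linear (\<lambda>w. real CARD('k) * multilinear_form A ((\<lambda>_. y)(p := w)))"
    by (intro linearI) (simp_all add: linear_add[OF lin] linear_scale[OF lin] algebra_simps del: fun_upd_apply)
  then show ?thesis unfolding ambient_grad_def by (rule inner_form_coordinates)
qed

lemma inner_ambient_hess:
  "w \<bullet> ambient_hess y v =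
     real CARD('k) * (real (CARD('k) - 1) * multilinear_form A ((\<lambda>_. y)(p := w, q := v)))"
proof -
  have lin: "linear (\<lambda>w. multilinear_form A ((\<lambda>_. y)(p := w, q := v)))"
    using linear_multilinear_form_slot[of A "(\<lambda>_. y)(q := v)" p] pq by (simp add: fun_upd_twist)
  have "linear (\<lambda>w. real CARD('k) * (real (CARD('k) - 1) *
      multilinear_form A ((\<lambda>_. y)(p := w, q := v))))"
    by (intro linearI) (simp_all add: linear_add[OF lin] linear_scale[OF lin] algebra_simps del: fun_upd_apply)
  then show ?thesis unfolding ambient_hess_def by (rule inner_form_coordinates)
qed

lemma has_derivative_form_power:
  "((\<lambda>y. A \<bullet> tensor_power y) has_derivative (\<lambda>v. v \<bullet> ambient_grad x)) (at x)"
proof -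
  have "((\<lambda>y. multilinear_form A (\<lambda>_. y)) has_derivative
      (\<lambda>v. \<Sum>j\<in>UNIV. multilinear_form A ((\<lambda>_. x)(j := v)))) (at x)"
    by (rule has_derivative_multilinear_form) simp
  moreover have "(\<Sum>j\<in>UNIV. multilinear_form A ((\<lambda>_. x)(j := v))) = v \<bullet> ambient_grad x" for v
  proof -
    have "(\<Sum>j\<in>UNIV. multilinear_form A ((\<lambda>_. x)(j := v)))
        = (\<Sum>j\<in>(UNIV :: 'k set). multilinear_form A ((\<lambda>_. x)(p := v)))"
      by (rule sum.cong[OF refl multilinear_form_fun_upd_swap[OF A]])
    then show ?thesis by (simp add: inner_ambient_grad)
  qed
  ultimately show ?thesis by (simp add: inner_tensor_power)
qed

lemma has_derivative_ambient_grad: "(ambient_grad has_derivative ambient_hess x) (at x)"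
proof -
  have "((\<lambda>y. multilinear_form A ((\<lambda>_. y)(p := w))) has_derivative
      (\<lambda>v. real (CARD('k) - 1) * multilinear_form A ((\<lambda>_. x)(p := w, q := v)))) (at x)" for w
  proof -
    \<comment> \<open>The slot \<open>p\<close> is constant, and each of the other \<open>k - 1\<close> slots contributes the same derivative.\<close>
    have 1: "((\<lambda>y. multilinear_form A (\<lambda>j. (if j = p then w else y))) has_derivative
        (\<lambda>v. \<Sum>j\<in>UNIV. multilinear_form A ((\<lambda>j. if j = p then w else x)(j := (if j = p then 0 else v))))) (at x)"
    proof (rule has_derivative_multilinear_form)
      show "((\<lambda>y. if j = p then w else y) has_derivative (\<lambda>v. if j = p then 0 else v)) (at x)" for j
        by (cases "j = p") auto
    qed
    have upd: "(\<lambda>j. if j = p then w else y) = (\<lambda>_. y)(p := w)" for y by auto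
    have 2: "(\<Sum>j\<in>UNIV. multilinear_form A ((\<lambda>j. if j = p then w else x)(j := (if j = p then 0 else v))))
        = real (CARD('k) - 1) * multilinear_form A ((\<lambda>_. x)(p := w, q := v))" for v
    proof -
      have z: "multilinear_form A (((\<lambda>_. x)(p := w))(p := 0)) = 0"
        using linear_0[OF linear_multilinear_form_slot] by blast
      have "(\<Sum>j\<in>UNIV. multilinear_form A ((\<lambda>j. if j = p then w else x)(j := (if j = p then 0 else v))))
        = (\<Sum>j\<in>UNIV - {p}. multilinear_form A ((\<lambda>j. if j = p then w else x)(j := (if j = p then 0 else v))))"
        using z unfolding upd by (subst sum.remove[of _ p]) auto
      also have "\<dots> = (\<Sum>j\<in>UNIV - {p}. multilinear_form A ((\<lambda>_. x)(p := w, q := v)))"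
        using multilinear_form_fun_upd2_swap[OF A _ pq] unfolding upd by (intro sum.cong) auto
      finally show ?thesis by simp
    qed
    show ?thesis using 1 unfolding 2 unfolding upd .
  qed
  then have "((\<lambda>y. ambient_grad y $ m) has_derivative (\<lambda>v. ambient_hess x v $ m)) (at x)" for m
    unfolding ambient_grad_def ambient_hess_def by (simp add: has_derivative_mult_right)
  then show ?thesis
    by (subst has_derivative_componentwise_within)
      (auto simp: Basis_vec_def inner_axis)
qed

lemma sphere_grad_form_power:
  "sphere_grad (\<lambda>y. A \<bullet> tensor_power y) y = ambient_grad y - (ambient_grad y \<bullet> y) *\<^sub>R y"
proof -
  have "D = ambient_grad y" if "GDERIV (\<lambda>y. A \<bullet> tensor_power y) y :> D" for D
  proof -
    have "(\<lambda>h. h \<bullet> D) = (\<lambda>h. h \<bullet> ambient_grad y)"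
      using that has_derivative_form_power has_derivative_unique unfolding gderiv_def by blast
    then show ?thesis using vector_eq_ldot by (meson fun_cong)
  qed
  then have "(THE D. GDERIV (\<lambda>y. A \<bullet> tensor_power y) y :> D) = ambient_grad y"
    using has_derivative_form_power by (intro the_equality) (auto simp: gderiv_def)
  then show ?thesis by (simp add: sphere_grad_def sphere_proj_def)
qed

text \<open>Differentiating \<open>grad y - (grad y \<bullet> y) y\<close>, the terms along \<open>x\<close> disappear under the projection; the
  correction \<open>grad x \<bullet> x\<close> is the curvature term of the sphere.\<close>

lemma sphere_hessian_form_power:
  assumes x: "x \<bullet> x = 1"
  shows "sphere_hessian (\<lambda>y. A \<bullet> tensor_power y) x v =
    sphere_proj x (ambient_hess x v) - (ambient_grad x \<bullet> x) *\<^sub>R sphere_proj x v"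
proof -
  let ?D = "\<lambda>v. ambient_hess x v - ((ambient_grad x \<bullet> x) *\<^sub>R v +
      (ambient_grad x \<bullet> v + ambient_hess x v \<bullet> x) *\<^sub>R x)"
  have "sphere_grad (\<lambda>y. A \<bullet> tensor_power y) = (\<lambda>y. ambient_grad y - (ambient_grad y \<bullet> y) *\<^sub>R y)"
    using sphere_grad_form_power by blast
  moreover have "((\<lambda>y. ambient_grad y - (ambient_grad y \<bullet> y) *\<^sub>R y) has_derivative ?D) (at x)"
    by (intro derivative_intros has_derivative_ambient_grad)
  ultimately have "frechet_derivative (sphere_grad (\<lambda>y. A \<bullet> tensor_power y)) (at x) = ?D"
    using frechet_derivative_at[symmetric] by simp
  then show ?thesis using x
    by (simp add: sphere_hessian_def sphere_proj_def algebra_simps inner_diff_left inner_add_left)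
qed

text \<open>The pairing of \<open>w\<close> with the gradient gives the first condition, and the pairing of \<open>w\<close> with the
  Hessian at \<open>v\<close> gives the second. The curvature term becomes \<open>A(x,\<dots>,x)\<close> by Euler's formula for
  homogeneous functions.\<close>

lemma degenerate_Z_eigenvector_kernel:
  assumes Z: "Z_eigenvector A x" and nd: "\<not> nondegenerate_Z_eigenvector A x"
  obtains v where "x \<bullet> x = 1" "v \<bullet> x = 0" "v \<bullet> v = 1"
    "\<And>w. w \<bullet> x = 0 \<Longrightarrow> multilinear_form A ((\<lambda>_. x)(p := w)) = 0"
    "\<And>w. w \<bullet> x = 0 \<Longrightarrow> real (CARD('k) - 1) * multilinear_form A ((\<lambda>_. x)(p := w, q := v))
        = multilinear_form A (\<lambda>_. x) * (w \<bullet> v)"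
proof -
  let ?f = "\<lambda>y. A \<bullet> tensor_power y"
  have crit: "sphere_critical_point ?f x" using Z by (simp add: Z_eigenvector_def)
  have x: "x \<bullet> x = 1" using crit by (simp add: sphere_critical_point_def dot_square_norm)
  have fd: "frechet_derivative ?f (at x) = (\<lambda>v. v \<bullet> ambient_grad x)"
    using has_derivative_form_power frechet_derivative_at by metis
  have eig: "multilinear_form A ((\<lambda>_. x)(p := w)) = 0" if "w \<bullet> x = 0" for w
    using crit that fd inner_ambient_grad by (auto simp: sphere_critical_point_def sphere_tangent_def)
  note hess = sphere_hessian_form_power[OF x]
  have lin_ah: "linear (ambient_hess x)" using has_derivative_ambient_grad has_derivative_linear by blast
  have lin: "linear (sphere_hessian ?f x)"
    unfolding hess sphere_proj_def
    by (intro linearI)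
      (simp_all add: linear_add[OF lin_ah] linear_scale[OF lin_ah] inner_add_left algebra_simps)
  obtain v0 where v0: "v0 \<in> sphere_tangent x" "v0 \<noteq> 0" "sphere_hessian ?f x v0 = 0"
    using degenerate_sphere_critical_point_kernel[OF crit _ lin] nd
    unfolding nondegenerate_Z_eigenvector_def by blast
  define v where "v = v0 /\<^sub>R norm v0"
  have v: "v \<bullet> x = 0" "v \<bullet> v = 1" "sphere_hessian ?f x v = 0"
    using v0 lin by (auto simp: v_def sphere_tangent_def linear_scale dot_square_norm power2_eq_square)
  have "real (CARD('k) - 1) * multilinear_form A ((\<lambda>_. x)(p := w, q := v))
        = multilinear_form A (\<lambda>_. x) * (w \<bullet> v)" if w: "w \<bullet> x = 0" for w
  proof -
    have gx: "ambient_grad x \<bullet> x = real CARD('k) * multilinear_form A (\<lambda>_. x)"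
    proof -
      have "(\<lambda>_. x)(p := x) = (\<lambda>_. x)" by auto
      then show ?thesis using inner_ambient_grad[of x x] by (simp add: inner_commute)
    qed
    have "0 = w \<bullet> sphere_hessian ?f x v" using v by simp
    also have "\<dots> = w \<bullet> ambient_hess x v - (ambient_grad x \<bullet> x) * (w \<bullet> v)"
      unfolding hess using w v by (simp add: sphere_proj_def inner_diff_right)
    also have "\<dots> = real CARD('k) * (real (CARD('k) - 1) * multilinear_form A ((\<lambda>_. x)(p := w, q := v))
         - multilinear_form A (\<lambda>_. x) * (w \<bullet> v))"
      unfolding inner_ambient_hess gx by (simp add: algebra_simps)
    finally show ?thesis by simp
  qed
  then show ?thesis using that x v eig by blast
qed

end

section \<open>Orthonormal pairs by two reflections\<close>

definition reflect :: "'a::real_inner \<Rightarrow> 'a \<Rightarrow> 'a" where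
  "reflect u z = z - (2 * (u \<bullet> z) / (u \<bullet> u)) *\<^sub>R u"

text \<open>The reflection with its denominator cleared, which is polynomial in both arguments.\<close>

definition scaled_reflect :: "'a::real_inner \<Rightarrow> 'a \<Rightarrow> 'a" where
  "scaled_reflect u z = (u \<bullet> u) *\<^sub>R z - (2 * (u \<bullet> z)) *\<^sub>R u"

lemma scaled_reflect_eq: "u \<noteq> 0 \<Longrightarrow> scaled_reflect u z = (u \<bullet> u) *\<^sub>R reflect u z"
  by (simp add: scaled_reflect_def reflect_def scaleR_diff_right)

lemma linear_reflect: "linear (reflect u)"
  by (intro linearI) (simp_all add: reflect_def inner_add_right algebra_simps add_divide_distrib)

lemma reflect_reflect: "u \<noteq> 0 \<Longrightarrow> reflect u (reflect u z) = z"
  by (simp add: reflect_def inner_diff_right algebra_simps)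

lemma reflect_inner: "u \<noteq> 0 \<Longrightarrow> reflect u y \<bullet> reflect u z = y \<bullet> z"
  by (simp add: reflect_def inner_diff_right inner_diff_left inner_commute field_simps)

lemma reflect_scale: "c \<noteq> 0 \<Longrightarrow> reflect (c *\<^sub>R u) z = reflect u z"
  by (simp add: reflect_def)

lemma reflect_diff:
  assumes "x \<bullet> x = y \<bullet> y" "x \<noteq> y"
  shows "reflect (x - y) x = y"
proof -
  have "2 * ((x - y) \<bullet> x) = (x - y) \<bullet> (x - y)"
    using assms(1) by (simp add: inner_diff_left inner_diff_right inner_commute)
  then show ?thesis using assms(2) by (simp add: reflect_def)
qed

text \<open>The first reflection takes \<open>e\<^sub>a\<close> to \<open>\<plusminus> x\<close>; the second fixes \<open>e\<^sub>a\<close> and takes \<open>e\<^sub>b\<close> to \<open>\<plusminus> v'\<close>, where \<open>v'\<close>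
  is the vector that the first one takes to \<open>v\<close>. The signs are chosen so that the relevant coordinates of
  \<open>e\<^sub>a \<mp> x\<close> and \<open>e\<^sub>b \<mp> v'\<close> are at least 1, and can be normalised to 1. In this way a
  single family of normalised vectors reaches all orthonormal pairs up to signs, instead of one family for
  each chart of projective space.\<close>

lemma orthonormal_pair_by_two_reflections:
  fixes x v :: "real ^ 'n::finite"
  assumes x: "x \<bullet> x = 1" and v: "v \<bullet> v = 1" and vx: "v \<bullet> x = 0" and ab: "a \<noteq> b"
  obtains \<epsilon> \<delta> :: real and u w where "\<epsilon> \<in> {1, -1}" "\<delta> \<in> {1, -1}"
    "u $ a = 1" "w $ a = 0" "w $ b = 1"
    "reflect u (reflect w (axis a 1)) = \<epsilon> *\<^sub>R x" "reflect u (reflect w (axis b 1)) = \<delta> *\<^sub>R v"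
proof -
  define \<epsilon> :: real where "\<epsilon> = (if x $ a \<le> 0 then 1 else -1)"
  define u0 where "u0 = axis a 1 - \<epsilon> *\<^sub>R x"
  have u0a: "u0 $ a \<ge> 1" by (simp add: u0_def \<epsilon>_def)
  then have u0: "u0 \<noteq> 0" by auto
  have ru0: "reflect u0 (axis a 1) = \<epsilon> *\<^sub>R x"
    unfolding u0_def using x u0 by (intro reflect_diff) (auto simp: \<epsilon>_def u0_def inner_axis_axis)
  define v' where "v' = reflect u0 v"
  have v'a: "v' $ a = 0"
  proof -
    have "v' $ a = reflect u0 v \<bullet> reflect u0 (reflect u0 (axis a 1))"
      by (simp add: v'_def reflect_reflect[OF u0] inner_axis)
    also have "\<dots> = \<epsilon> * (v \<bullet> x)" by (simp add: reflect_inner[OF u0] ru0)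
    finally show ?thesis using vx by simp
  qed
  have v'v': "v' \<bullet> v' = 1" by (simp add: v'_def reflect_inner[OF u0] v)
  define \<delta> :: real where "\<delta> = (if v' $ b \<le> 0 then 1 else -1)"
  define w0 where "w0 = axis b 1 - \<delta> *\<^sub>R v'"
  have w0b: "w0 $ b \<ge> 1" by (simp add: w0_def \<delta>_def)
  have w0a: "w0 $ a = 0" using v'a ab by (simp add: w0_def axis_def)
  have w0: "w0 \<noteq> 0" using w0b by auto
  have rw0: "reflect w0 (axis b 1) = \<delta> *\<^sub>R v'"
    unfolding w0_def using v'v' w0 by (intro reflect_diff) (auto simp: \<delta>_def w0_def inner_axis_axis)
  have rw0a: "reflect w0 (axis a 1) = axis a 1" using w0a by (simp add: reflect_def inner_axis)
  define u where "u = (1 / u0 $ a) *\<^sub>R u0"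
  define w where "w = (1 / w0 $ b) *\<^sub>R w0"
  have ru: "reflect u = reflect u0" and rw: "reflect w = reflect w0"
    using u0a w0b by (auto simp: u_def w_def reflect_scale fun_eq_iff)
  have rv: "reflect u0 (\<delta> *\<^sub>R v') = \<delta> *\<^sub>R v"
    using linear_scale[OF linear_reflect] by (metis v'_def reflect_reflect[OF u0])
  show ?thesis
  proof (rule that[of \<epsilon> \<delta> u w])
    show "u $ a = 1" "w $ a = 0" "w $ b = 1" using u0a w0a w0b by (auto simp: u_def w_def)
    show "reflect u (reflect w (axis a 1)) = \<epsilon> *\<^sub>R x"
      by (simp add: ru rw rw0a ru0)
    show "reflect u (reflect w (axis b 1)) = \<delta> *\<^sub>R v"
      by (simp add: ru rw rw0 rv)
  qed (auto simp: \<epsilon>_def \<delta>_def)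
qed

section \<open>Degenerate tensors in standard position\<close>

text \<open>The two conditions of \<open>degenerate_Z_eigenvector_kernel\<close>. They survive a sign change of
  \<open>v\<close>, in which the second one is linear, and of \<open>x\<close>, because the degrees \<open>k - 2\<close> and \<open>k\<close> in \<open>x\<close> of its two
  sides have the same parity.\<close>

definition degenerate_pair :: "('k::finite, 'n::finite) tensor \<Rightarrow> 'k \<Rightarrow> 'k \<Rightarrow> real ^ 'n \<Rightarrow> real ^ 'n \<Rightarrow> bool" where
  "degenerate_pair A p q x v \<longleftrightarrow>
     (\<forall>w. w \<bullet> x = 0 \<longrightarrow> multilinear_form A ((\<lambda>_. x)(p := w)) = 0 \<and>
       real (CARD('k) - 1) * multilinear_form A ((\<lambda>_. x)(p := w, q := v))
        = multilinear_form A (\<lambda>_. x) * (w \<bullet> v))"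

lemma degenerate_pair_uminus_right:
  assumes "degenerate_pair A p q x v" shows "degenerate_pair A p q x (- v)"
proof -
  have "multilinear_form A (X(q := - v)) = - multilinear_form A (X(q := v))" for X
    using linear_neg[OF linear_multilinear_form_slot] .
  then show ?thesis using assms by (simp add: degenerate_pair_def)
qed

lemma degenerate_pair_uminus_left:
  fixes A :: "('k::finite, 'n::finite) tensor"
  assumes "degenerate_pair A p q x v" shows "degenerate_pair A p q (- x) v"
  unfolding degenerate_pair_def
proof (intro allI impI)
  fix w assume "w \<bullet> (- x) = 0"
  then have w: "(- w) \<bullet> x = 0" by simp
  let ?s = "(-1::real) ^ CARD('k)"
  have "(\<lambda>_. - x)(p := w) = (\<lambda>j. (-1) *\<^sub>R ((\<lambda>_. x)(p := - w)) j)" by auto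
  then have 1: "multilinear_form A ((\<lambda>_. - x)(p := w)) = ?s * multilinear_form A ((\<lambda>_. x)(p := - w))"
    using multilinear_form_scale by metis
  have "(\<lambda>_. - x)(p := w, q := v) = (\<lambda>j. (-1) *\<^sub>R ((\<lambda>_. x)(p := - w, q := - v)) j)" by auto
  then have 2: "multilinear_form A ((\<lambda>_. - x)(p := w, q := v))
      = ?s * multilinear_form A ((\<lambda>_. x)(p := - w, q := - v))"
    using multilinear_form_scale by metis
  have 3: "multilinear_form A (\<lambda>_. - x) = ?s * multilinear_form A (\<lambda>_. x)"
    using multilinear_form_scale[of A "-1" "\<lambda>_. x"] by simp
  have "degenerate_pair A p q x (- v)" using assms by (rule degenerate_pair_uminus_right)
  then have "multilinear_form A ((\<lambda>_. x)(p := - w)) = 0"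
    "real (CARD('k) - 1) * multilinear_form A ((\<lambda>_. x)(p := - w, q := - v))
        = multilinear_form A (\<lambda>_. x) * ((- w) \<bullet> (- v))"
    using w unfolding degenerate_pair_def by blast+
  then show "multilinear_form A ((\<lambda>_. - x)(p := w)) = 0 \<and>
       real (CARD('k) - 1) * multilinear_form A ((\<lambda>_. - x)(p := w, q := v))
        = multilinear_form A (\<lambda>_. - x) * (w \<bullet> v)"
    unfolding 1 2 3 by (simp add: mult_ac)
qed

text \<open>The conditions of a degenerate pair for \<open>x = e\<^sub>a\<close> and \<open>v = e\<^sub>b\<close>, read off on \<open>w = e\<^sub>j\<close> for \<open>j \<noteq> a\<close>. Each of
  them prescribes one entry, and the prescribed entries belong to different orbits of indices.\<close>

definition in_standard_position :: "('k::finite, 'n::finite) tensor \<Rightarrow> 'k \<Rightarrow> 'k \<Rightarrow> 'n \<Rightarrow> 'n \<Rightarrow> bool" where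
  "in_standard_position B p q a b \<longleftrightarrow>
     (\<forall>j. j \<noteq> a \<longrightarrow> B $ ((\<lambda>_. a)(p := j)) = 0 \<and>
       B $ ((\<lambda>_. a)(p := j, q := b)) = (if j = b then B $ (\<lambda>_. a) / real (CARD('k) - 1) else 0))"

text \<open>The tensor \<open>B\<close> is \<open>A\<close> transported by the orthogonal map \<open>G\<close> that takes \<open>e\<^sub>a\<close>, \<open>e\<^sub>b\<close> to \<open>x\<close>, \<open>v\<close>.
  The two scaled reflections in the opposite order are the inverse of \<open>G\<close> up to the factor \<open>r\<close>. Each of
  the \<open>k\<close> arguments of the form contributes one such factor, and the factor \<open>r\<close> to the power \<open>- k\<close> in \<open>B\<close>
  cancels them; it does not disturb the standard position, which is a linear condition.\<close>

lemma degenerate_tensor_standard_position: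
  fixes A :: "('k::finite, 'n::finite) tensor"
  assumes A: "A \<in> symmetric_tensors" and deg: "degenerate_pair A p q x v"
    and k: "CARD('k) \<ge> 2" and u: "u \<noteq> 0" and w: "w \<noteq> 0"
    and x: "reflect u (reflect w (axis a 1)) = x" and v: "reflect u (reflect w (axis b 1)) = v"
  obtains B where "B \<in> symmetric_tensors" "in_standard_position B p q a b"
    "\<And>i. A $ i = multilinear_form B (\<lambda>j. scaled_reflect w (scaled_reflect u (axis (i j) 1)))"
proof -
  define G where "G = (\<lambda>z. reflect u (reflect w z))"
  define r where "r = (u \<bullet> u) * (w \<bullet> w)"
  define B where "B = inverse (r ^ CARD('k)) *\<^sub>R pull_back G A"
  have r: "r \<noteq> 0" using u w by (simp add: r_def)
  have linG: "linear G" unfolding G_def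
    using linear_compose[OF linear_reflect linear_reflect] by (simp add: o_def)
  have innG: "G y \<bullet> G z = y \<bullet> z" for y z by (simp add: G_def reflect_inner u w)
  have entry: "B $ i = inverse (r ^ CARD('k)) * multilinear_form A (\<lambda>l. G (axis (i l) 1))" for i
    by (simp add: B_def pull_back_def)
  have formB: "multilinear_form B X = inverse (r ^ CARD('k)) * multilinear_form A (\<lambda>j. G (X j))" for X
    unfolding multilinear_form_pull_back[OF linG, symmetric]
    by (simp add: B_def multilinear_form_def sum_distrib_left mult_ac)
  have Ga: "G (axis a 1) = x" and Gb: "G (axis b 1) = v" using x v by (auto simp: G_def)
  show ?thesis
  proof (rule that)
    show "B \<in> symmetric_tensors"
      using pull_back_symmetric[OF A, of G] by (simp add: B_def symmetric_tensors_def)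
    show "in_standard_position B p q a b"
      unfolding in_standard_position_def
    proof (intro allI impI)
      fix j assume j: "j \<noteq> a"
      \<comment> \<open>As \<open>G\<close> is orthogonal, \<open>G e\<^sub>j\<close> is tangent at \<open>x = G e\<^sub>a\<close> and can be tested in the conditions.\<close>
      let ?w = "G (axis j 1)"
      have wx: "?w \<bullet> x = 0" and wv: "?w \<bullet> v = (if j = b then 1 else 0)"
        using j unfolding Ga[symmetric] Gb[symmetric] innG by (auto simp: inner_axis_axis)
      have "(\<lambda>l. G (axis (((\<lambda>_. a)(p := j)) l) 1)) = (\<lambda>_. x)(p := ?w)"
        "(\<lambda>l. G (axis (((\<lambda>_. a)(p := j, q := b)) l) 1)) = (\<lambda>_. x)(p := ?w, q := v)"
        using Ga Gb by (auto simp: fun_eq_iff)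
      then have e: "B $ ((\<lambda>_. a)(p := j)) = inverse (r ^ CARD('k)) * multilinear_form A ((\<lambda>_. x)(p := ?w))"
        "B $ ((\<lambda>_. a)(p := j, q := b)) =
          inverse (r ^ CARD('k)) * multilinear_form A ((\<lambda>_. x)(p := ?w, q := v))"
        "B $ (\<lambda>_. a) = inverse (r ^ CARD('k)) * multilinear_form A (\<lambda>_. x)"
        unfolding entry by (simp_all only: Ga)
      have "multilinear_form A ((\<lambda>_. x)(p := ?w)) = 0"
        "real (CARD('k) - 1) * multilinear_form A ((\<lambda>_. x)(p := ?w, q := v))
          = multilinear_form A (\<lambda>_. x) * (if j = b then 1 else 0)"
        using deg wx unfolding wv[symmetric] degenerate_pair_def by blast+
      moreover have "real (CARD('k) - 1) \<noteq> 0" using k by simp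
      ultimately have "multilinear_form A ((\<lambda>_. x)(p := ?w)) = 0"
        "multilinear_form A ((\<lambda>_. x)(p := ?w, q := v))
          = (if j = b then multilinear_form A (\<lambda>_. x) / real (CARD('k) - 1) else 0)"
        by (auto simp: nonzero_eq_divide_eq mult_ac split: if_splits)
      then show "B $ ((\<lambda>_. a)(p := j)) = 0 \<and>
        B $ ((\<lambda>_. a)(p := j, q := b)) = (if j = b then B $ (\<lambda>_. a) / real (CARD('k) - 1) else 0)"
        unfolding e by auto
    qed
    fix i
    have "G (scaled_reflect w (scaled_reflect u z)) = r *\<^sub>R z" for z
      by (simp add: G_def r_def scaled_reflect_eq u w linear_scale[OF linear_reflect] reflect_reflect mult_ac)
    then show "A $ i = multilinear_form B (\<lambda>j. scaled_reflect w (scaled_reflect u (axis (i j) 1)))"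
      unfolding formB using r by (simp add: multilinear_form_scale multilinear_form_axis)
  qed
qed

lemma degenerate_Z_eigenvector_tensor:
  fixes A :: "('k::finite, 'n::finite) tensor"
  assumes A: "A \<in> symmetric_tensors" and pq: "p \<noteq> q" and k: "CARD('k) \<ge> 2" and ab: "a \<noteq> b"
    and Z: "Z_eigenvector A x" and nd: "\<not> nondegenerate_Z_eigenvector A x"
  obtains u w B where "u $ a = 1" "w $ a = 0" "w $ b = 1"
    "B \<in> symmetric_tensors" "in_standard_position B p q a b"
    "\<And>i. A $ i = multilinear_form B (\<lambda>j. scaled_reflect w (scaled_reflect u (axis (i j) 1)))"
proof -
  obtain v where xv: "x \<bullet> x = 1" "v \<bullet> v = 1" "v \<bullet> x = 0" and deg: "degenerate_pair A p q x v"
    using degenerate_Z_eigenvector_kernel[OF A pq Z nd] unfolding degenerate_pair_def by metis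
  obtain \<epsilon> \<delta> :: real and u w where s: "\<epsilon> \<in> {1, -1}" "\<delta> \<in> {1, -1}"
    and uw: "u $ a = 1" "w $ a = 0" "w $ b = 1"
    and rf: "reflect u (reflect w (axis a 1)) = \<epsilon> *\<^sub>R x" "reflect u (reflect w (axis b 1)) = \<delta> *\<^sub>R v"
    using orthonormal_pair_by_two_reflections[OF xv ab] by metis
  have "degenerate_pair A p q (\<epsilon> *\<^sub>R x) (\<delta> *\<^sub>R v)"
    using s deg by (auto intro!: degenerate_pair_uminus_left degenerate_pair_uminus_right)
  moreover have "u \<noteq> 0" "w \<noteq> 0" using uw by auto
  ultimately show ?thesis
    using degenerate_tensor_standard_position[OF A _ k _ _ rf] that uw by metis
qed

section \<open>Counting parameters\<close>

text \<open>The multiset of the values of an index determines its orbit under permutations of the positions, so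
  these multisets label the coordinates of the space of symmetric tensors.\<close>

definition index_type :: "('k::finite \<Rightarrow> 'n) \<Rightarrow> 'n multiset" where
  "index_type i = image_mset i (mset_set UNIV)"

lemma symmetric_tensor_index_type:
  fixes A :: "('k::finite, 'n::finite) tensor"
  assumes "A \<in> symmetric_tensors" "index_type i = index_type i'"
  shows "A $ i = A $ i'"
proof -
  obtain p where p: "p permutes (UNIV :: 'k set)" "\<forall>l\<in>UNIV. i l = i' (p l)"
    using image_mset_eq_implies_permutes[OF finite assms(2)[unfolded index_type_def]] by blast
  then have "i = i' \<circ> p" by auto
  then show ?thesis using assms(1) p(1) by (simp add: symmetric_tensors_def)
qed

lemma index_type_permute: "p permutes UNIV \<Longrightarrow> index_type (i \<circ> p) = index_type i"
  by (simp add: index_type_def image_mset.comp[symmetric, unfolded o_def] multiset.map_comp[symmetric]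
      image_mset_mset_set permutes_inj permutes_surj)

lemma index_type_upd:
  fixes p :: "'k::finite"
  shows "index_type ((\<lambda>_. a)(p := j)) = add_mset j (replicate_mset (CARD('k) - 1) a)"
proof -
  have "mset_set (UNIV :: 'k set) = add_mset p (mset_set (UNIV - {p}))"
    by (simp add: mset_set.remove)
  moreover have "image_mset ((\<lambda>_. a)(p := j)) (mset_set (UNIV - {p})) = image_mset (\<lambda>_. a) (mset_set (UNIV - {p}))"
    by (intro image_mset_cong) auto
  ultimately show ?thesis by (simp add: index_type_def image_mset_const_eq)
qed

lemma index_type_upd2:
  fixes p q :: "'k::finite"
  assumes "p \<noteq> q"
  shows "index_type ((\<lambda>_. a)(p := j, q := b)) = add_mset b (add_mset j (replicate_mset (CARD('k) - 2) a))"
proof -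
  have "mset_set (UNIV :: 'k set) = add_mset q (mset_set (UNIV - {q}))"
    by (simp add: mset_set.remove)
  also have "mset_set (UNIV - {q}) = add_mset p (mset_set (UNIV - {q} - {p}))"
    using assms by (simp add: mset_set.remove)
  finally have "mset_set (UNIV :: 'k set) = add_mset q (add_mset p (mset_set (UNIV - {q} - {p})))" .
  moreover have "image_mset ((\<lambda>_. a)(p := j, q := b)) (mset_set (UNIV - {q} - {p}))
      = image_mset (\<lambda>_. a) (mset_set (UNIV - {q} - {p}))"
    by (intro image_mset_cong) auto
  moreover have "card (UNIV - {q} - {p}) = CARD('k) - 2"
    using assms by simp
  ultimately show ?thesis using assms by (simp add: index_type_def image_mset_const_eq)
qed

lemma poly_in_scaled_reflect:
  fixes u z :: "('j \<Rightarrow> real) \<Rightarrow> real ^ 'n::finite"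
  assumes "finite J" "\<And>m. poly_in J (\<lambda>t. u t $ m)" "\<And>m. poly_in J (\<lambda>t. z t $ m)"
  shows "poly_in J (\<lambda>t. scaled_reflect (u t) (z t) $ m)"
  unfolding scaled_reflect_def inner_vec_def
  using assms by (auto intro!: poly_in_diff poly_in_mult poly_in_sum poly_in_const)

text \<open>The set \<open>J\<close> of parameters consists of the coordinates of \<open>u\<close> other than \<open>a\<close>, those of \<open>w\<close> other than \<open>a\<close>
  and \<open>b\<close>, and the entries of \<open>B\<close> at the orbits that the standard position does not prescribe. The entry
  \<open>B(e\<^sub>a,\<dots>,e\<^sub>a)\<close> is one of the free ones, and a multiple of it is the prescribed entry
  \<open>B(e\<^sub>a,\<dots>,e\<^sub>a,e\<^sub>b,e\<^sub>b)\<close>.\<close>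

theorem degenerate_tensors_polynomial_image:
  fixes a b :: "'n::finite" and p q :: "'k::finite"
  assumes pq: "p \<noteq> q" and k: "CARD('k) \<ge> 2" and ab: "a \<noteq> b"
  obtains J :: "('n + 'n + 'n multiset) set" and \<phi> :: "('k \<Rightarrow> 'n) \<Rightarrow> ('n + 'n + 'n multiset \<Rightarrow> real) \<Rightarrow> real"
  where "finite J" "card J < card (range (index_type :: ('k \<Rightarrow> 'n) \<Rightarrow> _))" "\<And>i. poly_in J (\<phi> i)"
    "\<And>A x. A \<in> symmetric_tensors \<Longrightarrow> Z_eigenvector A x \<Longrightarrow> \<not> nondegenerate_Z_eigenvector A x
       \<Longrightarrow> \<exists>t. \<forall>i. A $ i = \<phi> i t"
proof -
  let ?ty = "index_type :: ('k \<Rightarrow> 'n) \<Rightarrow> 'n multiset"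
  define type1 where "type1 j = ?ty ((\<lambda>_. a)(p := j))" for j
  define type2 where "type2 j = ?ty ((\<lambda>_. a)(p := j, q := b))" for j
  define top_type where "top_type = ?ty (\<lambda>_. a)"
  define E where "E = type1 ` (UNIV - {a}) \<union> type2 ` (UNIV - {a})"
  \<comment> \<open>\<open>E\<close> consists of the \<open>2 (n - 1)\<close> orbits whose entries the standard position prescribes.\<close>
  define J :: "('n + 'n + 'n multiset) set" where
    "J = (UNIV - {a}) <+> ((UNIV - {a, b}) <+> (range ?ty - E))"
  \<comment> \<open>The multiplicity of \<open>a\<close> separates the orbits of the two kinds of equations, and the orbit of the
    constant index from both.\<close>
  have count1: "count (type1 j) a = CARD('k) - 1" if "j \<noteq> a" for j
    using that by (simp add: type1_def index_type_upd)
  have count2: "count (type2 j) a = CARD('k) - 2" if "j \<noteq> a" for j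
    using that ab by (simp add: type2_def index_type_upd2[OF pq])
  have countT: "count top_type a = CARD('k)"
    by (simp add: top_type_def index_type_def image_mset_const_eq)
  have inj: "inj type1" "inj type2"
    by (auto simp: inj_on_def type1_def type2_def index_type_upd index_type_upd2[OF pq])
  have disj: "type1 ` (UNIV - {a}) \<inter> type2 ` (UNIV - {a}) = {}"
  proof -
    have "type1 i \<noteq> type2 j" if "i \<noteq> a" "j \<noteq> a" for i j
      using count1[OF that(1)] count2[OF that(2)] k by force
    then show ?thesis by auto
  qed
  have top: "top_type \<notin> E"
    using countT count1 count2 k unfolding E_def by force
  have cardE: "card E = 2 * (CARD('n) - 1)"
    unfolding E_def using disj inj by (simp add: card_Un_disjoint card_image inj_on_subset[OF _ subset_UNIV])
  have E: "E \<subseteq> range ?ty" by (auto simp: E_def type1_def type2_def)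
  have J: "finite J" by (simp add: J_def)
  have n2: "CARD('n) \<ge> 2"
    using card_mono[of "UNIV :: 'n set" "{a, b}"] ab by simp
  have cardJ: "card J < card (range ?ty)"
  proof -
    have "card J = (CARD('n) - 1) + ((CARD('n) - 2) + (card (range ?ty) - 2 * (CARD('n) - 1)))"
      using ab E cardE by (simp add: J_def card_Plus card_Diff_subset finite_subset[OF E])
    moreover have "2 * (CARD('n) - 1) \<le> card (range ?ty)"
      using card_mono[OF _ E] cardE by simp
    ultimately show ?thesis using n2 by linarith
  qed
  define ut :: "('n + 'n + 'n multiset \<Rightarrow> real) \<Rightarrow> real ^ 'n" where
    "ut t = (\<chi> m. if m = a then 1 else t (Inl m))" for t
  define wt :: "('n + 'n + 'n multiset \<Rightarrow> real) \<Rightarrow> real ^ 'n" where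
    "wt t = (\<chi> m. if m = a then 0 else if m = b then 1 else t (Inr (Inl m)))" for t
  define Bt :: "('n + 'n + 'n multiset \<Rightarrow> real) \<Rightarrow> ('k, 'n) tensor" where
    "Bt t = (\<chi> i. if ?ty i = type2 b then t (Inr (Inr top_type)) / real (CARD('k) - 1)
       else if ?ty i \<in> E then 0 else t (Inr (Inr (?ty i))))" for t
  define \<phi> where
    "\<phi> i t = multilinear_form (Bt t) (\<lambda>j. scaled_reflect (wt t) (scaled_reflect (ut t) (axis (i j) 1)))"
    for i t
  have topJ: "Inr (Inr top_type) \<in> J" using top by (auto simp: J_def top_type_def)
  have poly_ut: "poly_in J (\<lambda>t. ut t $ m)" for m
    by (cases "m = a") (auto simp: ut_def J_def intro!: poly_in_const poly_in_var J[unfolded J_def])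
  have poly_wt: "poly_in J (\<lambda>t. wt t $ m)" for m
    by (cases "m = a"; cases "m = b")
      (auto simp: wt_def J_def intro!: poly_in_const poly_in_var J[unfolded J_def])
  have poly_Bt: "poly_in J (\<lambda>t. Bt t $ i)" for i
  proof -
    have "poly_in J (\<lambda>t. t (Inr (Inr top_type)) * (1 / real (CARD('k) - 1)))"
      using J topJ by (intro poly_in_mult poly_in_var poly_in_const)
    then have "poly_in J (\<lambda>t. t (Inr (Inr top_type)) / real (CARD('k) - 1))" by simp
    moreover have "poly_in J (\<lambda>t. t (Inr (Inr (?ty i))))" if "?ty i \<notin> E"
      using J that by (intro poly_in_var) (auto simp: J_def)
    ultimately show ?thesis using poly_in_const[OF J, of 0]
      by (cases "?ty i = type2 b"; cases "?ty i \<in> E") (simp_all add: Bt_def del: of_nat_diff)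
  qed
  have "poly_in J (\<phi> i)" for i
    unfolding \<phi>_def multilinear_form_def
    by (intro poly_in_sum poly_in_mult poly_in_prod poly_in_scaled_reflect poly_in_const
        poly_ut poly_wt poly_Bt J)
  moreover have "\<exists>t. \<forall>i. A $ i = \<phi> i t"
    if A: "A \<in> symmetric_tensors" and Z: "Z_eigenvector A x" and nd: "\<not> nondegenerate_Z_eigenvector A x"
    for A :: "('k, 'n) tensor" and x
  proof -
    obtain u w B where uw: "u $ a = 1" "w $ a = 0" "w $ b = 1"
      and B: "B \<in> symmetric_tensors" and pos: "in_standard_position B p q a b"
      and AB: "\<And>i. A $ i = multilinear_form B (\<lambda>j. scaled_reflect w (scaled_reflect u (axis (i j) 1)))"
      using degenerate_Z_eigenvector_tensor[OF A pq k ab Z nd] by metis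
    define t where "t = case_sum (\<lambda>m. u $ m) (case_sum (\<lambda>m. w $ m) (\<lambda>M. B $ inv ?ty M))"
    have tB: "t (Inr (Inr (?ty i))) = B $ i" for i
    proof -
      have "?ty (inv ?ty (?ty i)) = ?ty i" by (simp add: f_inv_into_f)
      then have "B $ inv ?ty (?ty i) = B $ i" by (rule symmetric_tensor_index_type[OF B])
      then show ?thesis by (simp add: t_def)
    qed
    have "ut t = u" using uw by (auto simp: ut_def t_def vec_eq_iff)
    moreover have "wt t = w" using uw by (auto simp: wt_def t_def vec_eq_iff)
    moreover have "Bt t $ i = B $ i" for i
    proof (cases "?ty i \<in> E")
      case False
      moreover have "type2 b \<in> E" using ab by (auto simp: E_def)
      ultimately show ?thesis using tB by (auto simp: Bt_def)
    next
      case True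
      then consider j where "j \<noteq> a" "?ty i = type1 j" | j where "j \<noteq> a" "?ty i = type2 j"
        by (auto simp: E_def)
      then show ?thesis
      proof cases
        case 1
        have "type1 j \<noteq> type2 b" using disj 1 ab by blast
        moreover have "B $ i = 0"
          using symmetric_tensor_index_type[OF B 1(2)[unfolded type1_def]] pos 1(1)
          unfolding in_standard_position_def by metis
        ultimately show ?thesis using 1 True by (simp add: Bt_def)
      next
        case 2
        have "B $ i = (if j = b then B $ (\<lambda>_. a) / real (CARD('k) - 1) else 0)"
          using symmetric_tensor_index_type[OF B 2(2)[unfolded type2_def]] pos 2(1)
          unfolding in_standard_position_def by metis
        moreover have "type2 j = type2 b \<longleftrightarrow> j = b" using inj(2) by (auto simp: inj_on_def)
        ultimately show ?thesis using 2 True tB[of "\<lambda>_. a"] by (simp add: Bt_def top_type_def)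
      qed
    qed
    ultimately have "A $ i = \<phi> i t" for i using AB by (simp add: \<phi>_def vec_eq_iff[of "Bt t"] multilinear_form_def)
    then show ?thesis by blast
  qed
  ultimately show ?thesis using that J cardJ by blast
qed

section \<open>Genericity of nondegenerate Z-eigenvectors\<close>

text \<open>The relation between the parametrised entries, read as a polynomial in one entry per orbit, defines the
  exceptional set. It is proper because the entries of a symmetric tensor at different orbits are
  arbitrary.\<close>

theorem theorem4p11:
  assumes "CARD('k::finite) \<ge> 3"
  shows "\<exists>X :: ('k, 'n::finite) tensor set.
           zariski_closed_in symmetric_tensors X \<and> X \<subset> symmetric_tensors \<and>
           (\<forall>A \<in> symmetric_tensors - X. \<forall>x.
              Z_eigenvector A x \<longrightarrow> nondegenerate_Z_eigenvector A x)"
proof -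
  obtain p q :: 'k where pq: "p \<noteq> q"
  proof -
    have "\<not> card (UNIV :: 'k set) \<le> Suc 0" using assms by simp
    then show ?thesis using that by (auto simp: card_le_Suc0_iff_eq)
  qed
  show ?thesis
  proof (cases "\<exists>a b :: 'n. a \<noteq> b")
    case False
    have "nondegenerate_Z_eigenvector A x"
      if A: "A \<in> symmetric_tensors" and Z: "Z_eigenvector A x" for A :: "('k, 'n) tensor" and x
    proof (rule ccontr)
      assume "\<not> nondegenerate_Z_eigenvector A x"
      then obtain v where v: "x \<bullet> x = 1" "v \<bullet> x = 0" "v \<bullet> v = 1"
        using degenerate_Z_eigenvector_kernel[OF A pq Z] by metis
      obtain a :: 'n where "UNIV = {a}" using False by auto
      then have "sum g UNIV = sum g {a}" for g :: "'n \<Rightarrow> real" by (rule arg_cong)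
      then have "y \<bullet> z = y $ a * z $ a" for y z :: "real ^ 'n" by (simp add: inner_vec_def)
      then show False using v by auto
    qed
    moreover have "zariski_closed_in symmetric_tensors ({} :: ('k, 'n) tensor set)"
      unfolding zariski_closed_in_def
      by (intro exI[of _ "{\<lambda>_. 1}"]) (auto intro: real_polynomial_function.intros)
    moreover have "(0 :: ('k, 'n) tensor) \<in> symmetric_tensors" by (simp add: symmetric_tensors_def)
    ultimately show ?thesis by (intro exI[of _ "{}"]) auto
  next
    case True
    then obtain a b :: 'n where ab: "a \<noteq> b" by blast
    let ?I = "range (index_type :: ('k \<Rightarrow> 'n) \<Rightarrow> 'n multiset)"
    have k: "CARD('k) \<ge> 2" using assms by simp
    obtain J :: "('n + 'n + 'n multiset) set"
      and \<phi> :: "('k \<Rightarrow> 'n) \<Rightarrow> ('n + 'n + 'n multiset \<Rightarrow> real) \<Rightarrow> real"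
    where J: "finite J" "card J < card ?I" "\<And>i. poly_in J (\<phi> i)"
      and cover: "\<And>A x. A \<in> symmetric_tensors \<Longrightarrow> Z_eigenvector A x \<Longrightarrow> \<not> nondegenerate_Z_eigenvector A x
         \<Longrightarrow> \<exists>t. \<forall>i. A $ i = \<phi> i t"
      using degenerate_tensors_polynomial_image[OF pq k ab] by blast
    define rep :: "'n multiset \<Rightarrow> 'k \<Rightarrow> 'n" where "rep = inv index_type"
    have rep: "index_type (rep M) = M" if "M \<in> ?I" for M
      using that by (simp add: rep_def f_inv_into_f)
    obtain d c where van: "\<And>t. (\<Sum>\<alpha>\<in>exponents ?I d. c \<alpha> * monomial ?I \<alpha> (\<lambda>M. \<phi> (rep M) t)) = 0"
      and nonzero: "\<exists>f. (\<Sum>\<alpha>\<in>exponents ?I d. c \<alpha> * monomial ?I \<alpha> f) \<noteq> 0"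
    proof (rule polynomial_image_in_hypersurface[of ?I J "\<lambda>M. \<phi> (rep M)"])
      show "finite ?I" by simp
    qed (use J that in auto)
    define P :: "('k, 'n) tensor \<Rightarrow> real"
      where "P A = (\<Sum>\<alpha>\<in>exponents ?I d. c \<alpha> * monomial ?I \<alpha> (\<lambda>M. A $ rep M))" for A
    have polyP: "real_polynomial_function P"
      unfolding P_def monomial_def
      by (intro real_polynomial_function_sum real_polynomial_function_prod real_polynomial_function.intros
          real_polynomial_function_power bounded_linear_vec_nth finite_PiE) auto
    define X where "X = {A \<in> symmetric_tensors. P A = 0}"
    have "zariski_closed_in symmetric_tensors X"
      unfolding zariski_closed_in_def X_def using polyP by (intro exI[of _ "{P}"]) auto
    moreover have "X \<subset> symmetric_tensors"
    proof -
      obtain f where f: "(\<Sum>\<alpha>\<in>exponents ?I d. c \<alpha> * monomial ?I \<alpha> f) \<noteq> 0" using nonzero by blast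
      define A :: "('k, 'n) tensor" where "A = (\<chi> i. f (index_type i))"
      have "A \<in> symmetric_tensors" by (simp add: A_def symmetric_tensors_def index_type_permute)
      moreover have "monomial ?I \<alpha> (\<lambda>M. A $ rep M) = monomial ?I \<alpha> f" for \<alpha>
        unfolding monomial_def by (intro prod.cong) (auto simp: A_def rep)
      then have "P A \<noteq> 0" using f by (simp add: P_def)
      ultimately show ?thesis by (auto simp: X_def)
    qed
    moreover have "nondegenerate_Z_eigenvector A x"
      if A: "A \<in> symmetric_tensors - X" and Z: "Z_eigenvector A x" for A x
    proof (rule ccontr)
      assume "\<not> nondegenerate_Z_eigenvector A x"
      then obtain t where "\<forall>i. A $ i = \<phi> i t" using cover A Z by blast
      then have "P A = 0" using van[of t] by (simp add: P_def)
      then show False using A by (simp add: X_def)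
    qed
    ultimately show ?thesis by blast
  qed
qed

end
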